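(* Let $G$ be a (finite or infinite) group and let $A$ be a subset of $G$. Then the number of components of the Cayley graph $\mathrm{Cay}(G,A)$ equals $[G:\langle A\rangle]$, the index of $\langle A\rangle$ in $G$.
   Context: $\langle A\rangle$ denotes the subgroup of $G$ generated by $A$, i.e. the smallest subgroup of $G$ containing $A$. The (undirected) Cayley graph $\mathrm{Cay}(G,A)$, for an arbitrary subset $A$ of a group $G$ with identity $e$, is the graph with vertex set $G$ in which $\{u,v\}$ is an edge if and only if $u=va$ or $v=ua$ for some $a\in A\setminus\{e\}$. For a graph with vertex set $V$, the equivalence relation $\mathfrak{p}$ on $V$ is: $u\,\mathfrak{p}\,v$ if and only if $u=v$ or there is a path from $u$ to $v$. A component is the subgraph induced by an equivalence class of $\mathfrak{p}$. *)

theory Defs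
  imports "HOL-Algebra.Algebra" "HOL-Library.Equipollence"
begin

record 'a ugraph =
  vertices :: "'a set"
  edges :: "'a set set"

text \<open>A path is a sequence of pairwise distinct vertices in which consecutive ones are adjacent.\<close>

definition is_path :: "'a ugraph \<Rightarrow> 'a \<Rightarrow> 'a list \<Rightarrow> 'a \<Rightarrow> bool" where
  "is_path \<Gamma> u p v \<longleftrightarrow>
     p \<noteq> [] \<and> hd p = u \<and> last p = v \<and> distinct p \<and> set p \<subseteq> vertices \<Gamma> \<and>
     (\<forall>i. Suc i < length p \<longrightarrow> {p ! i, p ! Suc i} \<in> edges \<Gamma>)"

definition path_rel :: "'a ugraph \<Rightarrow> ('a \<times> 'a) set" where
  "path_rel \<Gamma> = {(u, v). u \<in> vertices \<Gamma> \<and> v \<in> vertices \<Gamma> \<and> (u = v \<or> (\<exists>p. is_path \<Gamma> u p v))}"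

definition induced_subgraph :: "'a ugraph \<Rightarrow> 'a set \<Rightarrow> 'a ugraph" where
  "induced_subgraph \<Gamma> S = \<lparr>vertices = S, edges = {e \<in> edges \<Gamma>. e \<subseteq> S}\<rparr>"

definition components_of_graph :: "'a ugraph \<Rightarrow> 'a ugraph set" where
  "components_of_graph \<Gamma> = induced_subgraph \<Gamma> ` (vertices \<Gamma> // path_rel \<Gamma>)"

definition cayley_graph :: "('a, 'b) monoid_scheme \<Rightarrow> 'a set \<Rightarrow> 'a ugraph" where
  "cayley_graph G A =
     \<lparr>vertices = carrier G,
      edges = {{u, v} | u v. u \<in> carrier G \<and> v \<in> carrier G \<and>
                 (\<exists>a \<in> A - {\<one>\<^bsub>G\<^esub>}. v = u \<otimes>\<^bsub>G\<^esub> a \<or> u = v \<otimes>\<^bsub>G\<^esub> a)}\<rparr>"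

end

theory Submission
  imports Defs
begin

text \<open>
  The vertices reachable from u are the u h with h in the subgroup H generated by A, so the
  components are the subgraphs induced by the left cosets of H; inversion maps left cosets
  bijectively to right cosets.
\<close>

text \<open>Adjacency as a relation, so that reachability becomes its reflexive transitive closure;
  paths themselves are awkward to concatenate, as their vertices must stay distinct.\<close>

definition adj :: "'a ugraph \<Rightarrow> ('a \<times> 'a) set" where
  "adj \<Gamma> = {(x, y). x \<in> vertices \<Gamma> \<and> y \<in> vertices \<Gamma> \<and> {x, y} \<in> edges \<Gamma>}"

lemma is_path_singleton: "u \<in> vertices \<Gamma> \<Longrightarrow> is_path \<Gamma> u [u] u"
  by (simp add: is_path_def)

lemma is_path_snoc:
  assumes "is_path \<Gamma> u p v" "(v, w) \<in> adj \<Gamma>" "w \<notin> set p"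
  shows "is_path \<Gamma> u (p @ [w]) w"
proof -
  have "{(p @ [w]) ! i, (p @ [w]) ! Suc i} \<in> edges \<Gamma>" if "i < length p" for i
  \<comment> \<open>Only the last index gives a new edge, from \<open>v\<close> to \<open>w\<close>;
    the earlier ones are edges of \<open>p\<close>.\<close>
  proof (cases "Suc i = length p")
    case True
    then have "p ! i = v"
      using assms(1) by (metis diff_Suc_1 is_path_def last_conv_nth)
    then show ?thesis using True that assms(2) by (simp add: nth_append adj_def)
  next
    case False
    then show ?thesis using that assms(1) by (simp add: nth_append is_path_def)
  qed
  then show ?thesis using assms by (simp add: is_path_def adj_def)
qed

lemma is_path_take:
  assumes "is_path \<Gamma> u p v" "i < length p"
  shows "is_path \<Gamma> u (take (Suc i) p) (p ! i)"
proof -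
  have "take (Suc i) p = take i p @ [p ! i]"
    using assms(2) by (rule take_Suc_conv_app_nth)
  then have "last (take (Suc i) p) = p ! i" by simp
  then show ?thesis
    using assms set_take_subset[of "Suc i" p]
    unfolding is_path_def by (simp add: subset_trans)
qed

text \<open>A walk is shortened to a path as it grows: if the next vertex already lies on the path,
  the path is cut back to it, otherwise the vertex is appended.\<close>

lemma rtrancl_adj_imp_is_path:
  assumes "(u, v) \<in> (adj \<Gamma>)\<^sup>*" "u \<in> vertices \<Gamma>"
  shows "\<exists>p. is_path \<Gamma> u p v"
  using assms(1)
proof (induction rule: rtrancl_induct)
  case base
  show ?case using is_path_singleton[OF assms(2)] by blast
next
  case (step v w)
  then obtain p where p: "is_path \<Gamma> u p v" by blast
  show ?case
  proof (cases "w \<in> set p")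
    case True
    then show ?thesis using is_path_take[OF p] by (metis in_set_conv_nth)
  next
    case False
    then show ?thesis using is_path_snoc[OF p step(2)] by blast
  qed
qed

lemma is_path_imp_rtrancl_adj:
  assumes "is_path \<Gamma> u p v"
  shows "(u, v) \<in> (adj \<Gamma>)\<^sup>*"
proof -
  have "(u, p ! i) \<in> (adj \<Gamma>)\<^sup>*" if "i < length p" for i
    using that
  proof (induction i)
    case 0
    then show ?case using assms by (simp add: is_path_def hd_conv_nth)
  next
    case (Suc i)
    then have "(p ! i, p ! Suc i) \<in> adj \<Gamma>"
      using assms by (auto simp: is_path_def adj_def)
    then show ?case using Suc by (meson Suc_lessD rtrancl.rtrancl_into_rtrancl)
  qed
  from this[of "length p - 1"] show ?thesis
    using assms by (auto simp: is_path_def last_conv_nth)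
qed

lemma path_rel_conv_adj:
  "path_rel \<Gamma> = {(u, v). u \<in> vertices \<Gamma> \<and> v \<in> vertices \<Gamma> \<and> (u, v) \<in> (adj \<Gamma>)\<^sup>*}"
  unfolding path_rel_def
  using rtrancl_adj_imp_is_path is_path_imp_rtrancl_adj by fastforce

text \<open>The vertex set is a field of the induced subgraph, so distinct classes give distinct
  components.\<close>

lemma components_eqpoll_quotient:
  "components_of_graph \<Gamma> \<approx> vertices \<Gamma> // path_rel \<Gamma>"
proof -
  have "inj_on (induced_subgraph \<Gamma>) S" for S
    by (rule inj_onI) (simp add: induced_subgraph_def)
  then show ?thesis
    unfolding components_of_graph_def by (rule inj_on_image_eqpoll_self)
qed

context group
begin

text \<open>Edges are unordered, so crossing one multiplies on the right by some \<open>a\<close> in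
  \<open>A\<close> or by its inverse.\<close>

lemma adj_cayley:
  assumes "A \<subseteq> carrier G" "(u, v) \<in> adj (cayley_graph G A)"
  shows "\<exists>h \<in> generate G A. v = u \<otimes> h"
proof -
  obtain a where a: "a \<in> A" "v = u \<otimes> a \<or> u = v \<otimes> a" "u \<in> carrier G" "v \<in> carrier G"
    using assms by (auto simp: adj_def cayley_graph_def doubleton_eq_iff)
  then have "v = u \<otimes> a \<or> v = u \<otimes> inv a"
    using assms(1) by (auto simp: m_assoc subset_iff)
  then show ?thesis using a(1) generate.incl generate.inv by metis
qed

text \<open>The start \<open>u\<close> stays arbitrary in the induction because a product
  \<open>h \<otimes> k\<close> is walked as \<open>h\<close> from \<open>u\<close>, then
  \<open>k\<close> from \<open>u \<otimes> h\<close>.\<close>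

lemma rtrancl_adj_cayley_generate:
  assumes "A \<subseteq> carrier G" "h \<in> generate G A" "u \<in> carrier G"
  shows "(u, u \<otimes> h) \<in> (adj (cayley_graph G A))\<^sup>*"
  using assms(2,3)
proof (induction arbitrary: u rule: generate.induct)
  case one
  then show ?case by simp
next
  case (incl a)
  show ?case
  \<comment> \<open>The identity yields no edge, but then the walk is empty.\<close>
  proof (cases "a = \<one>")
    case False
    then have "(u, u \<otimes> a) \<in> adj (cayley_graph G A)"
      using incl assms(1) by (auto simp: adj_def cayley_graph_def)
    then show ?thesis by blast
  qed (use incl in simp)
next
  case (inv a)
  show ?case
  proof (cases "a = \<one>")
    case False
    have "a \<in> carrier G" using inv assms(1) by blast
    \<comment> \<open>The edge labelled \<open>a\<close> from \<open>u \<otimes> inv a\<close> to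
      \<open>u\<close> is crossed backwards.\<close>
    then have "(u \<otimes> inv a) \<otimes> a = u" using inv by (simp add: m_assoc)
    then have "(u, u \<otimes> inv a) \<in> adj (cayley_graph G A)"
      using inv False \<open>a \<in> carrier G\<close>
      by (simp add: adj_def cayley_graph_def) (metis DiffI inv_closed m_closed singletonD)
    then show ?thesis by blast
  qed (use inv in simp)
next
  case (eng h k)
  then have "h \<in> carrier G" "k \<in> carrier G"
    using generate_in_carrier[OF assms(1)] by blast+
  then show ?case
    using eng.IH(1)[of u] eng.IH(2)[of "u \<otimes> h"] eng.prems
    by (simp add: m_assoc)
qed

lemma rtrancl_adj_cayley:
  assumes "A \<subseteq> carrier G" "u \<in> carrier G"
  shows "(u, v) \<in> (adj (cayley_graph G A))\<^sup>* \<longleftrightarrow> v \<in> u <#\<^bsub>G\<^esub> generate G A"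
proof
  assume "(u, v) \<in> (adj (cayley_graph G A))\<^sup>*"
  then have "\<exists>h \<in> generate G A. v = u \<otimes> h"
  proof (induction rule: rtrancl_induct)
    case base
    show ?case using generate.one[of G A] assms(2) by force
  next
    case (step v w)
    then show ?case
      using adj_cayley[OF assms(1) step(2)] assms
      by (metis generate.eng generate_in_carrier m_assoc)
  qed
  then show "v \<in> u <#\<^bsub>G\<^esub> generate G A" by (auto simp: l_coset_def)
next
  assume "v \<in> u <#\<^bsub>G\<^esub> generate G A"
  then show "(u, v) \<in> (adj (cayley_graph G A))\<^sup>*"
    using rtrancl_adj_cayley_generate assms by (auto simp: l_coset_def)
qed

lemma quotient_path_rel_cayley:
  assumes "A \<subseteq> carrier G"
  shows "vertices (cayley_graph G A) // path_rel (cayley_graph G A)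
           = lcosets generate G A"
proof -
  have "path_rel (cayley_graph G A) `` {u} = u <#\<^bsub>G\<^esub> generate G A" if "u \<in> carrier G" for u
    using rtrancl_adj_cayley[OF assms that] that
      \<comment> \<open>This puts the members of the coset among the vertices, as
        \<open>path_rel\<close> demands.\<close>
      l_coset_subset_G[OF generate_incl[OF assms] that]
    by (auto simp: path_rel_conv_adj cayley_graph_def)
  then show ?thesis by (auto simp: quotient_def LCOSETS_def cayley_graph_def)
qed

text \<open>The inverse of \<open>u \<otimes> h\<close> is \<open>inv h \<otimes> inv u\<close>, and
  inversion maps \<open>H\<close> onto itself.\<close>

lemma inv_image_l_coset:
  assumes "subgroup H G" "u \<in> carrier G"
  shows "m_inv G ` (u <#\<^bsub>G\<^esub> H) = H #> inv u"
proof -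
  interpret H: subgroup H G by fact
  have "m_inv G ` (u <#\<^bsub>G\<^esub> H) = (\<lambda>h. inv (u \<otimes> h)) ` H"
    by (auto simp: l_coset_def)
  also have "\<dots> = (\<lambda>h. h \<otimes> inv u) ` m_inv G ` H"
    using assms(2) by (simp add: inv_mult_group image_image cong: image_cong)
  also have "m_inv G ` H = H"
    by (force intro: image_eqI[where x = "inv _"])
  finally show ?thesis by (auto simp: r_coset_def)
qed

text \<open>Taking images under inversion needs no choice of coset representatives, and is injective
  on subsets of the carrier because inversion is injective there.\<close>

lemma lcosets_eqpoll_rcosets:
  assumes "subgroup H G"
  shows "lcosets H \<approx> rcosets H"
proof -
  have "inj_on ((`) (m_inv G)) (lcosets H)"
    using inj_on_image_Pow[OF inv_inj] lcosets_subset_PowG[OF assms] by (rule inj_on_subset)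
  moreover have "(`) (m_inv G) ` (lcosets H) = rcosets H"
  proof -
    have "(`) (m_inv G) ` (lcosets H) = (\<lambda>u. m_inv G ` (u <#\<^bsub>G\<^esub> H)) ` carrier G"
      by (auto simp: LCOSETS_def)
    \<comment> \<open>Reindexing by \<open>inv u\<close> loses no coset, since inversion permutes
      the carrier.\<close>
    also have "\<dots> = (\<lambda>u. H #> u) ` m_inv G ` carrier G"
      by (simp add: image_image inv_image_l_coset[OF assms] cong: image_cong)
    also have "m_inv G ` carrier G = carrier G"
      by (force intro: image_eqI[where x = "inv _"])
    finally show ?thesis by (auto simp: RCOSETS_def)
  qed
  ultimately show ?thesis
    unfolding eqpoll_def bij_betw_def by blast
qed

end

text \<open>Equipollence also compares infinite cardinalities, for which \<open>card\<close> would
  return 0.\<close>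

theorem theorem2p12:
  fixes G :: "('a, 'b) monoid_scheme" and A :: "'a set"
  assumes "group G" and "A \<subseteq> carrier G"
  shows "components_of_graph (cayley_graph G A) \<approx> rcosets\<^bsub>G\<^esub> (generate G A)"
proof -
  interpret group G by fact
  show ?thesis
    using components_eqpoll_quotient[of "cayley_graph G A"]
      lcosets_eqpoll_rcosets[OF generate_is_subgroup[OF assms(2)]]
    unfolding quotient_path_rel_cayley[OF assms(2)] by (rule eqpoll_trans)
qed

end
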